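(* Let $\Bbbk$ be a field and $N\ge3$. The set $$\{a(\underline j)\ \text{in normal form}\}\cup\{1\}$$ is a $\Bbbk$-basis of the affine nilTemperley-Lieb algebra $\mathrm{n}\widehat{\mathrm{TL}}_N$.
   Context: The affine nilTemperley-Lieb algebra $\mathrm{n}\widehat{\mathrm{TL}}_N$ ($N\ge3$) is the unital associative $\Bbbk$-algebra with generators $a_0,\dots,a_{N-1}$ and relations $a_i^2=0$, $a_ia_j=a_ja_i$ for $i-j\not\equiv\pm1 \pmod N$, and $a_ia_{i+1}a_i=a_{i+1}a_ia_{i+1}=0$ for all $i$, all indices modulo $N$. For a word $\underline j=(j_1,\dots,j_r)$ with letters in $\mathbb Z/N\mathbb Z=\{0,\dots,N-1\}$, put $a(\underline j)=a_{j_1}\cdots a_{j_r}$. Normal form: let $\underline j$ be a nonempty word with $a(\underline j)\ne0$. Let $\underline j^{(0)}$ be the subword of all those letters $i$ of $\underline j$ which have no letter $i-1$ to their right in $\underline j$; remove these letters from $\underline j$ to get a word $\underline j'$, and repeat with $\underline j'$ to get $\underline j^{(1)}$, and so on until no letters are left, producing nonempty words $\underline j^{(0)},\underline j^{(1)},\dots,\underline j^{(m)}$ (each letter occurs at most once in each of them). Let $\hat\imath$ be the largest element of $\{0,\dots,N-1\}$ (usual order) which does not occur in $\underline j^{(0)}$ while $\hat\imath-1$ (modulo $N$) does. For each $n$ reorder the letters of $\underline j^{(n)}$ so that they increase from left to right with respect to the order $\hat\imath+n\prec\hat\imath+n+1\prec\dots\prec\hat\imath+n+N-1$ on $\mathbb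 Z/N\mathbb Z$. The resulting expression $a(\underline j^{(m)})a(\underline j^{(m-1)})\cdots a(\underline j^{(1)})a(\underline j^{(0)})$ is the normal form of $a(\underline j)$. A monomial "in normal form" is always a nonzero, nonconstant monomial (nonempty word) equal, as an expression, to its own normal form. *)

theory Defs
  imports
    "HOL-Library.Poly_Mapping"
    "HOL-Algebra.QuotRing"
    "Jordan_Normal_Form.VS_Connect"
begin

section \<open>Free associative algebras\<close>

text \<open>Lists carry no monoid instance, so the free monoid is a type of its own, written
  additively: the ring structure on \<^typ>\<open>'m \<Rightarrow>\<^sub>0 'k\<close> is convolution with respect to an additive
  (not necessarily commutative) monoid \<^typ>\<open>'m\<close>.  Over the free monoid this is
  multiplication of noncommutative polynomials.\<close>

datatype 'a free_monoid = Word (letters: "'a list")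

instantiation free_monoid :: (type) monoid_add
begin

definition zero_free_monoid :: "'a free_monoid" where
  "0 = Word []"

definition plus_free_monoid :: "'a free_monoid \<Rightarrow> 'a free_monoid \<Rightarrow> 'a free_monoid" where
  "u + v = Word (letters u @ letters v)"

instance
  by standard (simp_all add: zero_free_monoid_def plus_free_monoid_def)

end

lemma letters_zero [simp]: "letters 0 = []"
  by (simp add: zero_free_monoid_def)

lemma letters_plus [simp]: "letters (u + v) = letters u @ letters v"
  by (simp add: plus_free_monoid_def)

type_synonym 'k ncpoly = "nat free_monoid \<Rightarrow>\<^sub>0 'k"

text \<open>The free unital associative algebra on the generators \<open>0, \<dots>, N - 1\<close>.\<close>

definition free_algebra :: "nat \<Rightarrow> ('k::field, 'k ncpoly) module" where
  "free_algebra N =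
    \<lparr>carrier = {p. \<forall>w \<in> Poly_Mapping.keys p. set (letters w) \<subseteq> {..<N}},
     mult = (*), one = 1, zero = 0, add = (+),
     smult = (\<lambda>c p. Poly_Mapping.map ((*) c) p)\<rparr>"

definition var :: "nat \<Rightarrow> 'k::field ncpoly" where
  "var i = Poly_Mapping.single (Word [i]) 1"

text \<open>Scalars act on cosets elementwise, like multiplication in \<^const>\<open>FactRing\<close>.\<close>

definition quotient_algebra ::
    "('k, 'a) module \<Rightarrow> 'a set \<Rightarrow> ('k, 'a set) module" where
  "quotient_algebra A I =
    ring.extend (A Quot I) (module.fields (\<lambda>c X. \<Union>x\<in>X. I +>\<^bsub>A\<^esub> (c \<odot>\<^bsub>A\<^esub> x)))"


section \<open>The affine nilTemperley-Lieb algebra\<close>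

definition succ_mod :: "nat \<Rightarrow> nat \<Rightarrow> nat" where
  "succ_mod N i = (i + 1) mod N"

definition pred_mod :: "nat \<Rightarrow> nat \<Rightarrow> nat" where
  "pred_mod N i = (i + N - 1) mod N"

definition nTL_relations :: "nat \<Rightarrow> 'k::field ncpoly set" where
  "nTL_relations N =
     {var i * var i |i. i < N}
   \<union> {var i * var j - var j * var i |i j.
        i < N \<and> j < N \<and> succ_mod N i \<noteq> j \<and> succ_mod N j \<noteq> i}
   \<union> {var i * var (succ_mod N i) * var i |i. i < N}
   \<union> {var (succ_mod N i) * var i * var (succ_mod N i) |i. i < N}"

definition nTL_ideal :: "nat \<Rightarrow> 'k::field ncpoly set" where
  "nTL_ideal N = Idl\<^bsub>free_algebra N\<^esub> (nTL_relations N)"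

definition nTL :: "nat \<Rightarrow> ('k::field, 'k ncpoly set) module" where
  "nTL N = quotient_algebra (free_algebra N) (nTL_ideal N)"

lemma ring_free_algebra: "ring (free_algebra N :: ('k::field, 'k ncpoly) module)"
proof -
  let ?A = "free_algebra N :: ('k, 'k ncpoly) module"
  have add: "p + q \<in> carrier ?A" if "p \<in> carrier ?A" "q \<in> carrier ?A" for p q
    using that Poly_Mapping.keys_add[of p q] unfolding free_algebra_def by auto
  have mult: "p * q \<in> carrier ?A" if pq: "p \<in> carrier ?A" "q \<in> carrier ?A" for p q
  proof -
    have "set (letters w) \<subseteq> {..<N}" if w: "w \<in> Poly_Mapping.keys (p * q)" for w
    proof -
      obtain u v where "w = u + v" "u \<in> Poly_Mapping.keys p" "v \<in> Poly_Mapping.keys q"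
        using w keys_mult[of p q] by blast
      with pq show ?thesis by (auto simp: free_algebra_def)
    qed
    then show ?thesis by (simp add: free_algebra_def)
  qed
  have neg: "- p \<in> carrier ?A" if "p \<in> carrier ?A" for p
    using that unfolding free_algebra_def by simp
  have ops: "p \<oplus>\<^bsub>?A\<^esub> q = p + q" "p \<otimes>\<^bsub>?A\<^esub> q = p * q" "\<zero>\<^bsub>?A\<^esub> = 0" "\<one>\<^bsub>?A\<^esub> = 1" for p q
    by (simp_all add: free_algebra_def)
  have units: "0 \<in> carrier ?A" "1 \<in> carrier ?A"
    by (simp_all add: free_algebra_def)
  have "abelian_group ?A"
  proof (rule abelian_groupI)
    fix p assume "p \<in> carrier ?A"
    then show "\<exists>q\<in>carrier ?A. q \<oplus>\<^bsub>?A\<^esub> p = \<zero>\<^bsub>?A\<^esub>"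
      using neg[of p] by (intro bexI[of _ "- p"]) (simp_all add: ops)
  qed (simp_all add: ops add units ac_simps)
  moreover have "monoid ?A"
    by (rule monoidI) (simp_all add: ops mult units mult.assoc)
  ultimately show ?thesis
    by (rule ringI) (simp_all add: ops distrib_left distrib_right)
qed

lemma nTL_relations_subset:
  assumes "N > 0"
  shows "nTL_relations N \<subseteq> carrier (free_algebra N :: ('k::field, 'k ncpoly) module)"
proof -
  let ?A = "free_algebra N :: ('k, 'k ncpoly) module"
  interpret A: ring ?A by (rule ring_free_algebra)
  have v: "var i \<in> carrier ?A" if "i < N" for i
    using that by (simp add: free_algebra_def var_def)
  have s: "succ_mod N i < N" for i
    using assms by (simp add: succ_mod_def)
  have m: "p * q \<in> carrier ?A" if "p \<in> carrier ?A" "q \<in> carrier ?A" for p q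
    using A.m_closed[OF that] by (simp add: free_algebra_def)
  have d: "p - q \<in> carrier ?A" if "p \<in> carrier ?A" "q \<in> carrier ?A" for p q
    using that keys_diff[of p q] unfolding free_algebra_def by auto
  show ?thesis
    unfolding nTL_relations_def by (auto intro!: v s m d)
qed

lemma nTL_ideal: "N > 0 \<Longrightarrow> ideal (nTL_ideal N) (free_algebra N :: ('k::field, 'k ncpoly) module)"
  unfolding nTL_ideal_def
  by (rule ring.genideal_ideal[OF ring_free_algebra nTL_relations_subset])

lemma nTL_simps:
  "carrier (nTL N) = carrier (free_algebra N Quot nTL_ideal N)"
  "mult (nTL N) = mult (free_algebra N Quot nTL_ideal N)"
  "one (nTL N) = one (free_algebra N Quot nTL_ideal N)"
  "zero (nTL N) = zero (free_algebra N Quot nTL_ideal N)"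
  "add (nTL N) = add (free_algebra N Quot nTL_ideal N)"
  "smult (nTL N) = (\<lambda>c X. \<Union>x\<in>X. nTL_ideal N +>\<^bsub>free_algebra N\<^esub> (c \<odot>\<^bsub>free_algebra N\<^esub> x))"
  by (simp_all add: nTL_def quotient_algebra_def ring.defs module.defs)

lemma ring_nTL:
  assumes "N > 0"
  shows "ring (nTL N :: ('k::field, 'k ncpoly set) module)"
proof -
  let ?Q = "free_algebra N Quot nTL_ideal N :: 'k ncpoly set ring"
  interpret Q: ring ?Q
    by (rule ideal.quotient_is_ring[OF nTL_ideal[OF assms]])
  note d = nTL_simps
  show ?thesis
  proof (rule ringI)
    show "abelian_group (nTL N :: ('k, 'k ncpoly set) module)"
      by (rule abelian_groupI)
        (use Q.a_assoc Q.a_comm Q.l_zero Q.zero_closed Q.add.m_closed Q.add.l_inv_ex in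
          \<open>simp_all add: d\<close>)
    show "monoid (nTL N :: ('k, 'k ncpoly set) module)"
      by (rule monoidI) (use Q.m_assoc Q.m_closed Q.one_closed in \<open>simp_all add: d\<close>)
  qed (use Q.l_distr Q.r_distr in \<open>simp_all add: d\<close>)
qed

lemma nTL_smult_coset:
  assumes "N > 0" and p: "p \<in> carrier (free_algebra N)"
  shows "(c::'k::field) \<odot>\<^bsub>nTL N\<^esub> (nTL_ideal N +>\<^bsub>free_algebra N\<^esub> p) =
    nTL_ideal N +>\<^bsub>free_algebra N\<^esub> (c \<odot>\<^bsub>free_algebra N\<^esub> p)"
proof -
  let ?A = "free_algebra N :: ('k, 'k ncpoly) module" and ?I = "nTL_ideal N :: 'k ncpoly set"
  interpret I: ideal ?I ?A by (rule nTL_ideal[OF assms(1)])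
  define s :: "'k ncpoly" where "s = Poly_Mapping.single 0 c"
  have s: "s \<in> carrier ?A"
    by (simp add: s_def free_algebra_def)
  have sm: "c \<odot>\<^bsub>?A\<^esub> x = s \<otimes>\<^bsub>?A\<^esub> x" for x
    by (simp add: free_algebra_def s_def mult_map_scale_conv_mult)
  have "?I +>\<^bsub>?A\<^esub> (s \<otimes>\<^bsub>?A\<^esub> x) = ?I +>\<^bsub>?A\<^esub> (s \<otimes>\<^bsub>?A\<^esub> p)" if "x \<in> ?I +>\<^bsub>?A\<^esub> p" for x
  proof -
    have x: "x \<in> carrier ?A"
      using that p I.a_r_coset_subset_G[OF I.a_subset p] by blast
    have "?I +>\<^bsub>?A\<^esub> x = ?I +>\<^bsub>?A\<^esub> p"
      using I.a_repr_independence[OF that p I.a_subgroup] by simp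
    then show ?thesis
      using I.rcoset_mult_add[OF s x] I.rcoset_mult_add[OF s p] by simp
  qed
  moreover have "p \<in> ?I +>\<^bsub>?A\<^esub> p"
    by (rule I.a_rcos_self[OF p])
  ultimately show ?thesis
    unfolding nTL_simps sm by blast
qed

lemma vectorspace_nTL:
  assumes "N > 0"
  shows "vectorspace (class_ring :: 'k::field ring) (nTL N)"
proof -
  let ?A = "free_algebra N :: ('k, 'k ncpoly) module" and ?I = "nTL_ideal N :: 'k ncpoly set"
  let ?V = "nTL N :: ('k, 'k ncpoly set) module"
  interpret I: ideal ?I ?A by (rule nTL_ideal[OF assms])
  interpret V: ring ?V by (rule ring_nTL[OF assms])
  have rep: "\<exists>p \<in> carrier ?A. X = ?I +>\<^bsub>?A\<^esub> p" if "X \<in> carrier ?V" for X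
    using that by (auto simp: nTL_simps FactRing_def A_RCOSETS_def')
  have cos: "?I +>\<^bsub>?A\<^esub> p \<in> carrier ?V" if "p \<in> carrier ?A" for p
    using that by (auto simp: nTL_simps FactRing_def A_RCOSETS_def')
  have add: "(?I +>\<^bsub>?A\<^esub> p) \<oplus>\<^bsub>?V\<^esub> (?I +>\<^bsub>?A\<^esub> q) = ?I +>\<^bsub>?A\<^esub> (p \<oplus>\<^bsub>?A\<^esub> q)"
    if "p \<in> carrier ?A" "q \<in> carrier ?A" for p q
    using I.a_rcos_sum[OF that] by (simp add: nTL_simps FactRing_def)
  have sc: "c \<odot>\<^bsub>?A\<^esub> p \<in> carrier ?A" if "p \<in> carrier ?A" for c p
  proof -
    have "Poly_Mapping.single 0 c \<in> carrier ?A"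
      by (simp add: free_algebra_def)
    from I.m_closed[OF this that] show ?thesis
      by (simp add: free_algebra_def mult_map_scale_conv_mult)
  qed
  have sm: "c \<odot>\<^bsub>?V\<^esub> (?I +>\<^bsub>?A\<^esub> p) = ?I +>\<^bsub>?A\<^esub> (c \<odot>\<^bsub>?A\<^esub> p)" if "p \<in> carrier ?A" for c p
    by (rule nTL_smult_coset[OF assms that])
  have scA: "c \<odot>\<^bsub>?A\<^esub> p = Poly_Mapping.single 0 c * p" "p \<oplus>\<^bsub>?A\<^esub> q = p + q" for c p q
    by (simp_all add: free_algebra_def mult_map_scale_conv_mult)
  have pc: "p + q \<in> carrier ?A" if "p \<in> carrier ?A" "q \<in> carrier ?A" for p q
    using I.a_closed[OF that] by (simp add: scA)
  note sc' = sc[unfolded scA] and sm' = sm[unfolded scA] and add' = add[unfolded scA]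
  have "module (class_ring :: 'k ring) ?V"
  proof (rule moduleI)
    show "cring (class_ring :: 'k ring)" by (rule class_cring.cring_axioms)
    show "abelian_group ?V" by (rule V.abelian_group_axioms)
    fix c d :: 'k and X Y assume X: "X \<in> carrier ?V" and Y: "Y \<in> carrier ?V"
    obtain p q where p: "p \<in> carrier ?A" "X = ?I +>\<^bsub>?A\<^esub> p" and q: "q \<in> carrier ?A" "Y = ?I +>\<^bsub>?A\<^esub> q"
      using rep X Y by blast
    show "c \<odot>\<^bsub>?V\<^esub> X \<in> carrier ?V"
      using p by (simp add: sm cos sc)
    show "c \<odot>\<^bsub>?V\<^esub> (X \<oplus>\<^bsub>?V\<^esub> Y) = c \<odot>\<^bsub>?V\<^esub> X \<oplus>\<^bsub>?V\<^esub> c \<odot>\<^bsub>?V\<^esub> Y"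
      using p q by (simp add: sm' add' sc' pc distrib_left)
    show "(c \<oplus>\<^bsub>class_ring\<^esub> d) \<odot>\<^bsub>?V\<^esub> X = c \<odot>\<^bsub>?V\<^esub> X \<oplus>\<^bsub>?V\<^esub> d \<odot>\<^bsub>?V\<^esub> X"
      using p by (simp add: sm' add' sc' single_add distrib_right)
    show "(c \<otimes>\<^bsub>class_ring\<^esub> d) \<odot>\<^bsub>?V\<^esub> X = c \<odot>\<^bsub>?V\<^esub> (d \<odot>\<^bsub>?V\<^esub> X)"
      using p by (simp add: sm' sc' mult_single mult.assoc[symmetric])
    show "\<one>\<^bsub>class_ring\<^esub> \<odot>\<^bsub>?V\<^esub> X = X"
      using p by (simp add: sm')
  qed
  then show ?thesis
    by (intro vectorspace.intro class_field)
qed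

definition nTL_gen :: "nat \<Rightarrow> nat \<Rightarrow> 'k::field ncpoly set" where
  "nTL_gen N i = nTL_ideal N +>\<^bsub>free_algebra N\<^esub> var i"

definition nTL_monomial :: "nat \<Rightarrow> nat list \<Rightarrow> 'k::field ncpoly set" where
  "nTL_monomial N js = foldr (\<lambda>i x. nTL_gen N i \<otimes>\<^bsub>nTL N\<^esub> x) js \<one>\<^bsub>nTL N\<^esub>"


section \<open>Normal form of a word\<close>

text \<open>\<open>top_layer N js\<close> is the subword of the letters \<open>i\<close> without a letter \<open>i - 1\<close> to their
  right in \<open>js\<close>, and \<open>lower_part N js\<close> is what remains after removing them.\<close>

fun top_layer :: "nat \<Rightarrow> nat list \<Rightarrow> nat list" where
  "top_layer N [] = []"
| "top_layer N (i # js) =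
    (if pred_mod N i \<in> set js then top_layer N js else i # top_layer N js)"

fun lower_part :: "nat \<Rightarrow> nat list \<Rightarrow> nat list" where
  "lower_part N [] = []"
| "lower_part N (i # js) =
    (if pred_mod N i \<in> set js then i # lower_part N js else lower_part N js)"

lemma length_lower_part: "js \<noteq> [] \<Longrightarrow> length (lower_part N js) < length js"
proof (induction js)
  case (Cons i js)
  then show ?case by (cases "js = []") auto
qed simp

function layers :: "nat \<Rightarrow> nat list \<Rightarrow> nat list list" where
  "layers N js = (if js = [] then [] else top_layer N js # layers N (lower_part N js))"
  by auto
termination
  by (relation "measure (\<lambda>(N, js). length js)") (auto intro: length_lower_part)

declare layers.simps [simp del]

text \<open>The set below is nonempty for every nonempty word in \<open>0, \<dots>, N - 1\<close>: the top layer is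
  nonempty and never contains all \<open>N\<close> letters, since then each last occurrence of \<open>i - 1\<close> would
  precede that of \<open>i\<close>, cyclically in \<open>i\<close>.\<close>

definition hat_index :: "nat \<Rightarrow> nat list \<Rightarrow> nat" where
  "hat_index N js =
    Max {i. i < N \<and> i \<notin> set (top_layer N js) \<and> pred_mod N i \<in> set (top_layer N js)}"

text \<open>Position of \<open>i\<close> in the order \<open>s, s + 1, \<dots>, s + N - 1\<close> on residues modulo \<open>N\<close>.\<close>

definition cyclic_pos :: "nat \<Rightarrow> nat \<Rightarrow> nat \<Rightarrow> int" where
  "cyclic_pos N s i = (int i - int s) mod int N"

definition normal_form :: "nat \<Rightarrow> nat list \<Rightarrow> nat list" where
  "normal_form N js =
    concat (rev (map (\<lambda>n. sort_key (cyclic_pos N (hat_index N js + n)) (layers N js ! n))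
      [0..<length (layers N js)]))"

definition normal_form_monomials :: "nat \<Rightarrow> 'k::field ncpoly set set" where
  "normal_form_monomials N =
    {nTL_monomial N js |js. js \<noteq> [] \<and> set js \<subseteq> {..<N} \<and>
       (nTL_monomial N js :: 'k ncpoly set) \<noteq> \<zero>\<^bsub>nTL N\<^esub> \<and> normal_form N js = js}"

end

theory Submission
  imports Defs
begin

text \<open>All defining relations of the algebra either equate two words or send a word to zero.  Such an
  algebra has the set of its nonzero monomials as a basis, where words with the same value count
  once.  They span trivially.  They are independent because for each nonzero monomial \<open>m\<close> the
  indicator function of the words with value \<open>m\<close> is compatible with the relations, and so it
  extends to a linear functional that vanishes on the ideal (\<open>relation_compatible_vanishes\<close>,
  \<open>relation_compatible_indicator\<close>).

  It remains to see that every nonzero monomial other than \<open>1\<close> is the value of a word in normal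
  form.  The normal form of a word \<open>w\<close> with nonzero value turns out to be equivalent to \<open>w\<close> under
  the commutation relations (\<open>trace_eq_normal_form\<close>) and to depend on the commutation class of \<open>w\<close>
  only (\<open>normal_form_trace_eq_cong\<close>).  So it has the same value as \<open>w\<close> and is its own normal form.

  The first of these two facts rests on the observation that in a word with nonzero value both
  \<open>i - 1\<close> and \<open>i + 1\<close> occur between any two consecutive letters \<open>i\<close> (\<open>neighbour_between\<close>).  This
  allows the letters of the top layer to be moved to the right end (\<open>trace_eq_lower_top\<close>), and, layer
  by layer, the word becomes the concatenation of its layers.  Within a layer, \<open>i\<close> stands to the left
  of \<open>i + 1\<close> whenever both occur, and each layer is contained in the cyclic shift by one of the layer
  above it (\<open>pred_in_top_layer\<close>).  So an order that starts at \<open>hat_index + n\<close>, a letter outside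
  the \<open>n\<close>-th layer, never asks for \<open>i\<close> and \<open>i + 1\<close> to be interchanged, and the layers can be
  sorted by commutations.\<close>

section \<open>Commutation classes of words\<close>

definition comm :: "nat \<Rightarrow> nat \<Rightarrow> nat \<Rightarrow> bool" where
  "comm N i j \<longleftrightarrow> i < N \<and> j < N \<and> succ_mod N i \<noteq> j \<and> succ_mod N j \<noteq> i"

lemma comm_sym: "comm N i j \<Longrightarrow> comm N j i"
  by (auto simp: comm_def)

lemma pred_mod_eq_iff:
  assumes "i < N" "j < N"
  shows "pred_mod N i = j \<longleftrightarrow> succ_mod N j = i"
proof (cases "i = 0")
  case True
  with assms show ?thesis
    by (cases "Suc j = N") (auto simp: pred_mod_def succ_mod_def)
next
  case False
  then obtain k where k: "i = Suc k" by (cases i) auto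
  have "(i + N - 1) mod N = k" using assms k by simp
  with assms k show ?thesis
    by (cases "Suc j = N") (auto simp: pred_mod_def succ_mod_def)
qed

text \<open>Only the commutation relations identify words with each other; every other relation sends a
  word to zero.  So \<open>trace_eq\<close> is equality in the partially commutative monoid with these
  commutations.\<close>

inductive trace_eq :: "nat \<Rightarrow> nat list \<Rightarrow> nat list \<Rightarrow> bool" for N where
  refl [intro!, simp]: "trace_eq N w w"
| swap: "trace_eq N w (u @ i # j # v) \<Longrightarrow> comm N i j \<Longrightarrow> trace_eq N w (u @ j # i # v)"

lemma trace_eq_trans [trans]:
  assumes "trace_eq N u v" "trace_eq N v w"
  shows "trace_eq N u w"
  using assms(2,1) by induction (auto intro: trace_eq.swap)

lemma trace_eq_swap: "comm N i j \<Longrightarrow> trace_eq N (u @ i # j # v) (u @ j # i # v)"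
  by (rule trace_eq.swap) auto

lemma trace_eq_context: "trace_eq N u v \<Longrightarrow> trace_eq N (x @ u @ y) (x @ v @ y)"
proof (induction rule: trace_eq.induct)
  case (swap w u i j v)
  then show ?case using trace_eq.swap[of N _ "x @ u" i j "v @ y"] by simp
qed auto

lemmas trace_eq_append_left = trace_eq_context[where y = "[]", simplified]
lemmas trace_eq_append_right = trace_eq_context[where x = "[]", simplified]

lemma trace_eq_append:
  "trace_eq N u u' \<Longrightarrow> trace_eq N v v' \<Longrightarrow> trace_eq N (u @ v) (u' @ v')"
  by (rule trace_eq_trans[OF trace_eq_append_right trace_eq_append_left])

lemma trace_eq_Cons: "trace_eq N u v \<Longrightarrow> trace_eq N (i # u) (i # v)"
  using trace_eq_append_left[of N u v "[i]"] by simp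

lemma trace_eq_mset: "trace_eq N u v \<Longrightarrow> mset u = mset v"
  by (induction rule: trace_eq.induct) auto

lemma trace_eq_set: "trace_eq N u v \<Longrightarrow> set u = set v"
  by (metis mset_eq_setD trace_eq_mset)

lemma trace_eq_move_right: "\<forall>j\<in>set v. comm N i j \<Longrightarrow> trace_eq N (i # v) (v @ [i])"
proof (induction v)
  case (Cons j v)
  then have "trace_eq N (i # j # v) (j # i # v)"
    using trace_eq_swap[of N i j "[]" v] by simp
  also have "trace_eq N (j # i # v) (j # v @ [i])"
    using Cons by (intro trace_eq_Cons) auto
  finally show ?case by simp
qed simp

lemma trace_eq_move_left: "\<forall>j\<in>set v. comm N i j \<Longrightarrow> trace_eq N (v @ [i]) (i # v)"
proof (induction v)
  case (Cons j v)
  then have "trace_eq N (j # v @ [i]) (j # i # v)"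
    by (intro trace_eq_Cons) auto
  also have "trace_eq N (j # i # v) (i # j # v)"
    using trace_eq_swap[of N j i "[]" v] comm_sym Cons by simp
  finally show ?case by simp
qed simp

section \<open>Words that commutations cannot bring to zero\<close>

definition forbidden :: "nat \<Rightarrow> nat list set" where
  "forbidden N = (\<Union>i<N. {[i, i], [i, succ_mod N i, i], [succ_mod N i, i, succ_mod N i]})"

definition reduced :: "nat \<Rightarrow> nat list \<Rightarrow> bool" where
  "reduced N w \<longleftrightarrow> (\<forall>u x v. trace_eq N w (u @ x @ v) \<longrightarrow> x \<notin> forbidden N)"

lemma reduced_trace_eq: "reduced N w \<Longrightarrow> trace_eq N w w' \<Longrightarrow> reduced N w'"
  unfolding reduced_def by (blast intro: trace_eq_trans)

lemma reduced_factor: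
  assumes "reduced N (x @ w @ y)" shows "reduced N w"
  unfolding reduced_def
proof (intro allI impI)
  fix u z v assume "trace_eq N w (u @ z @ v)"
  from trace_eq_context[OF this, of x y] assms show "z \<notin> forbidden N"
    unfolding reduced_def by (metis append.assoc)
qed

text \<open>If a neighbour \<open>c\<close> of \<open>i\<close> is missing between two consecutive letters \<open>i\<close>, only the other
  neighbour \<open>d\<close> can obstruct moving the two letters \<open>i\<close> together.  Were \<open>d\<close> to occur twice there,
  the same claim for the shorter stretch between two consecutive letters \<open>d\<close> would yield a further
  \<open>i\<close>.  So \<open>d\<close> occurs at most once, and commutations produce \<open>i i\<close> or \<open>i d i\<close>.\<close>

lemma neighbour_between:
  assumes "reduced N w" "set w \<subseteq> {..<N}" "w = u @ i # v @ i # x" "i \<notin> set v"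
    and "c = pred_mod N i \<or> c = succ_mod N i"
  shows "c \<in> set v"
  using assms
proof (induction "length v" arbitrary: u i v x c rule: less_induct)
  case less
  note w = less.prems(3)
  have iN: "i < N" and vN: "set v \<subseteq> {..<N}" using less.prems(2) w by auto
  show ?case
  proof (rule ccontr)
    assume c: "c \<notin> set v"
    show False
    proof (cases "\<forall>j\<in>set v. comm N i j")
      case True
      have "trace_eq N w (u @ v @ [i, i] @ x)"
        using trace_eq_context[OF trace_eq_move_right[OF True], of u "i # x"] w by simp
      then show False
        using less.prems(1) iN unfolding reduced_def forbidden_def
        by (metis (no_types, lifting) UN_iff append.assoc insertI1 lessThan_iff)
    next
      case False
      then obtain d where d: "d \<in> set v" "\<not> comm N i d" by blast
      then have dN: "d < N" using vN by auto
      have dadj: "succ_mod N i = d \<or> succ_mod N d = i"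
        using d iN dN by (auto simp: comm_def)
      obtain v1 v2 where v: "v = v1 @ d # v2" "d \<notin> set v1"
        using d(1) by (meson split_list_first)
      have d2: "d \<notin> set v2"
      proof
        assume "d \<in> set v2"
        then obtain y z where v2: "v2 = y @ d # z" "d \<notin> set y"
          by (meson split_list_first)
        have "i \<in> set y"
        proof (rule less.hyps[of y "u @ i # v1" d "z @ i # x"])
          show "i = pred_mod N d \<or> i = succ_mod N d"
            using dadj pred_mod_eq_iff[OF dN iN] by auto
        qed (use v v2 w less.prems(1,2) in auto)
        then show False using less.prems(4) v v2 by simp
      qed
      have comm: "comm N i e" if "e \<in> set v1 \<union> set v2" for e
      proof -
        have eN: "e < N" and "e \<noteq> c" "e \<noteq> d" "c \<noteq> d" using that v d2 vN c d by auto
        then show ?thesis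
          using less.prems(5) dadj iN dN eN pred_mod_eq_iff[OF iN eN] pred_mod_eq_iff[OF iN dN]
          by (auto simp: comm_def)
      qed
      have "trace_eq N w (u @ v1 @ i # d # v2 @ i # x)"
        using trace_eq_context[OF trace_eq_move_right, of v1 N i u "d # v2 @ i # x"] comm w v
        by simp
      also have "trace_eq N \<dots> (u @ v1 @ [i, d, i] @ v2 @ x)"
        using trace_eq_context[OF trace_eq_move_left, of v2 N i "u @ v1 @ [i, d]" x] comm
        by simp
      finally have "[i, d, i] \<notin> forbidden N"
        using less.prems(1) unfolding reduced_def by (metis append.assoc)
      then show False using dadj iN dN by (auto simp: forbidden_def)
    qed
  qed
qed

section \<open>Splitting off the top layer\<close>

lemma set_layer_split: "set js = set (top_layer N js) \<union> set (lower_part N js)"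
  by (induction js) auto

lemma lower_part_pred: "i \<in> set (lower_part N js) \<Longrightarrow> pred_mod N i \<in> set js"
  by (induction js) (auto split: if_splits)

text \<open>A letter \<open>i\<close> of the top layer must move to the right past the later letters of the lower
  part.  A letter \<open>i - 1\<close> does not follow it.  Nor does another \<open>i\<close>, since \<open>i - 1\<close> would have to
  occur between the two.  A letter \<open>i + 1\<close> of the lower part would itself be followed by an \<open>i\<close>.\<close>

lemma trace_eq_lower_top:
  assumes "reduced N js" "set js \<subseteq> {..<N}"
  shows "trace_eq N js (lower_part N js @ top_layer N js)"
  using assms
proof (induction js)
  case (Cons i js)
  have red: "reduced N js" using Cons.prems(1) reduced_factor[of N "[i]" js "[]"] by simp
  have IH: "trace_eq N (i # js) (i # lower_part N js @ top_layer N js)"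
    using Cons red by (intro trace_eq_Cons) auto
  show ?case
  proof (cases "pred_mod N i \<in> set js")
    case True
    with IH show ?thesis by simp
  next
    case False
    have iN: "i < N" using Cons.prems(2) by simp
    have i: "i \<notin> set js"
    proof
      assume "i \<in> set js"
      then obtain v x where "js = v @ i # x" "i \<notin> set v" by (meson split_list_first)
      with neighbour_between[OF Cons.prems, of "[]" i v x "pred_mod N i"] False
      show False by simp
    qed
    have "comm N i k" if k: "k \<in> set (lower_part N js)" for k
    proof -
      have kN: "k < N" and "k \<in> set js" using k set_layer_split Cons.prems(2) by auto
      moreover have "pred_mod N k \<in> set js" using k by (rule lower_part_pred)
      ultimately show ?thesis
        using False i iN pred_mod_eq_iff[OF kN iN] pred_mod_eq_iff[OF iN kN]
        by (auto simp: comm_def)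
    qed
    then have "trace_eq N (i # lower_part N js @ top_layer N js) (lower_part N js @ i # top_layer N js)"
      using trace_eq_append_right[OF trace_eq_move_right, of "lower_part N js" N i "top_layer N js"]
      by simp
    with IH show ?thesis using False by (auto intro: trace_eq_trans)
  qed
qed simp

text \<open>Each letter of one layer is the cyclic successor of a letter of the layer above it.  Hence a
  residue missing from the top layer stays missing when both it and the layer index increase by
  one, which is why the order used for the \<open>n\<close>-th layer may start at the \<open>n\<close>-fold shift of
  \<^const>\<open>hat_index\<close>.\<close>

lemma pred_in_top_layer:
  "i \<in> set (top_layer N (lower_part N js)) \<Longrightarrow> pred_mod N i \<in> set (top_layer N js)"
proof (induction js)
  case (Cons j js)
  then show ?case using set_layer_split[of js N] by (auto split: if_splits)
qed simp

text \<open>Membership in the top layer depends on the relative order of letters \<open>i\<close> and \<open>i - 1\<close> only,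
  and commutations never interchange these.\<close>

lemma commuting_swap_layers:
  assumes "comm N i j"
  shows "trace_eq N (top_layer N (u @ i # j # v)) (top_layer N (u @ j # i # v))"
    and "trace_eq N (lower_part N (u @ i # j # v)) (lower_part N (u @ j # i # v))"
proof (induction u)
  case Nil
  have "pred_mod N i \<noteq> j" "pred_mod N j \<noteq> i"
    using assms pred_mod_eq_iff by (auto simp: comm_def)
  moreover have "trace_eq N (i # j # x) (j # i # x)" for x
    using trace_eq_swap[OF assms, of "[]"] by simp
  ultimately show "trace_eq N (top_layer N ([] @ i # j # v)) (top_layer N ([] @ j # i # v))"
    and "trace_eq N (lower_part N ([] @ i # j # v)) (lower_part N ([] @ j # i # v))"
    by auto
next
  case (Cons c u)
  then show "trace_eq N (top_layer N ((c # u) @ i # j # v)) (top_layer N ((c # u) @ j # i # v))"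
    and "trace_eq N (lower_part N ((c # u) @ i # j # v)) (lower_part N ((c # u) @ j # i # v))"
    by (auto intro: trace_eq_Cons)
qed

lemma trace_eq_top_layer:
  "trace_eq N w w' \<Longrightarrow> trace_eq N (top_layer N w) (top_layer N w')"
  by (induction rule: trace_eq.induct) (auto intro: commuting_swap_layers trace_eq_trans)

lemma trace_eq_lower_part:
  "trace_eq N w w' \<Longrightarrow> trace_eq N (lower_part N w) (lower_part N w')"
  by (induction rule: trace_eq.induct) (auto intro: commuting_swap_layers trace_eq_trans)

lemma trace_eq_layers:
  "trace_eq N w w' \<Longrightarrow> list_all2 (trace_eq N) (layers N w) (layers N w')"
proof (induction N w arbitrary: w' rule: layers.induct)
  case (1 N w)
  have "w = [] \<longleftrightarrow> w' = []" using trace_eq_set[OF 1(2)] by auto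
  with 1 trace_eq_top_layer trace_eq_lower_part show ?case
    by (subst (1 2) layers.simps) auto
qed

section \<open>Sorting a layer\<close>

text \<open>Insertion sort interchanges neighbouring letters only where the left one has the larger key.\<close>

lemma trace_eq_sort_key:
  fixes f :: "nat \<Rightarrow> 'b::linorder"
  assumes "sorted_wrt (\<lambda>x y. f y < f x \<longrightarrow> comm N x y) xs"
  shows "trace_eq N xs (sort_key f xs)"
  using assms
proof (induction xs)
  case (Cons x xs)
  have ins: "trace_eq N (x # ys) (insort_key f x ys)"
    if "\<forall>y\<in>set ys. f y < f x \<longrightarrow> comm N x y" for ys
    using that
  proof (induction ys)
    case (Cons y ys)
    show ?case
    proof (cases "f x \<le> f y")
      case False
      then have "trace_eq N (x # y # ys) (y # x # ys)"
        using Cons trace_eq_swap[of N x y "[]" ys] by simp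
      also have "trace_eq N (y # x # ys) (y # insort_key f x ys)"
        using Cons by (intro trace_eq_Cons) auto
      finally show ?thesis using False by simp
    qed simp
  qed simp
  have "trace_eq N (x # xs) (x # sort_key f xs)"
    using Cons by (intro trace_eq_Cons) auto
  also have "trace_eq N \<dots> (insort_key f x (sort_key f xs))"
    using Cons.prems by (intro ins) auto
  finally show ?case by simp
qed simp

text \<open>The order that starts at \<open>s\<close> puts \<open>x\<close> before \<open>x + 1\<close> unless it is cut exactly between
  them.\<close>

lemma cyclic_pos_descent:
  assumes "x < N" "cyclic_pos N s (succ_mod N x) < cyclic_pos N s x"
  shows "succ_mod N x = s mod N"
proof -
  let ?p = "cyclic_pos N s x"
  have p: "0 \<le> ?p" "?p < int N" using assms(1) by (auto simp: cyclic_pos_def)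
  have "cyclic_pos N s (succ_mod N x) = (?p + 1) mod int N"
    by (simp add: cyclic_pos_def succ_mod_def of_nat_mod mod_simps algebra_simps)
  with assms(2) p have "cyclic_pos N s (succ_mod N x) = 0"
    by (cases "?p + 1 = int N") auto
  then have "int N dvd int (succ_mod N x) - int s"
    by (simp add: cyclic_pos_def mod_eq_0_iff_dvd)
  then have "int (succ_mod N x) mod int N = int s mod int N"
    by (simp add: mod_eq_dvd_iff)
  then have "succ_mod N x mod N = s mod N"
    by (metis of_nat_eq_iff of_nat_mod)
  then show ?thesis by (simp add: succ_mod_def)
qed

lemma inj_on_cyclic_pos: "inj_on (cyclic_pos N s) {..<N}"
proof (rule inj_onI)
  fix x y assume xy: "x \<in> {..<N}" "y \<in> {..<N}" "cyclic_pos N s x = cyclic_pos N s y"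
  then have "int x mod int N = int y mod int N"
    by (simp add: cyclic_pos_def mod_eq_dvd_iff del: of_nat_mod mod_pos_pos_trivial)
  with xy(1,2) show "x = y" by (simp flip: of_nat_mod)
qed

text \<open>In the top layer \<open>i\<close> stands to the left of \<open>i + 1\<close> whenever both occur.  An order that starts
  at a letter outside the layer agrees with this, so sorting never interchanges \<open>i\<close> and \<open>i + 1\<close>.\<close>

lemma trace_eq_sort_top_layer:
  assumes "set js \<subseteq> {..<N}" "s mod N \<notin> set (top_layer N js)"
  shows "trace_eq N (top_layer N js) (sort_key (cyclic_pos N s) (top_layer N js))"
proof (rule trace_eq_sort_key)
  have "sorted_wrt (\<lambda>x y. y \<noteq> pred_mod N x) (top_layer N js)"
  proof (induction js)
    case (Cons i js)
    then show ?case using set_layer_split[of js N] by auto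
  qed simp
  moreover have "comm N x y"
    if "x \<in> set (top_layer N js)" "y \<in> set (top_layer N js)" "y \<noteq> pred_mod N x"
      "cyclic_pos N s y < cyclic_pos N s x" for x y
  proof -
    have xN: "x < N" and yN: "y < N" using that(1,2) assms(1) set_layer_split[of js N] by auto
    have "succ_mod N x \<noteq> y" using cyclic_pos_descent[OF xN] that assms(2) by metis
    with xN yN that(3) show ?thesis using pred_mod_eq_iff[OF xN yN] by (auto simp: comm_def)
  qed
  ultimately show "sorted_wrt (\<lambda>x y. cyclic_pos N s y < cyclic_pos N s x \<longrightarrow> comm N x y) (top_layer N js)"
    by (rule_tac sorted_wrt_mono_rel) auto
qed

section \<open>The normal form of a word\<close>

text \<open>The arrangement in \<^const>\<open>normal_form\<close> with an arbitrary start \<open>s\<close> in place of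
  \<^const>\<open>hat_index\<close>, so that the passage to the lower part, which replaces \<open>s\<close> by \<open>s + 1\<close>, can be
  an induction step.\<close>

definition stack :: "nat \<Rightarrow> nat \<Rightarrow> nat list list \<Rightarrow> nat list" where
  "stack N s Ls =
    concat (rev (map (\<lambda>n. sort_key (cyclic_pos N (s + n)) (Ls ! n)) [0..<length Ls]))"

lemma stack_Nil: "stack N s [] = []"
  by (simp add: stack_def)

lemma stack_Cons: "stack N s (L # Ls) = stack N (Suc s) Ls @ sort_key (cyclic_pos N s) L"
proof -
  have "map (\<lambda>n. sort_key (cyclic_pos N (s + n)) ((L # Ls) ! n)) [0..<Suc (length Ls)] =
    sort_key (cyclic_pos N s) L # map (\<lambda>n. sort_key (cyclic_pos N (Suc s + n)) (Ls ! n)) [0..<length Ls]"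
    by (subst map_upt_Suc) simp
  then show ?thesis unfolding stack_def by (simp del: upt_Suc)
qed

lemma trace_eq_stack:
  assumes "reduced N js" "set js \<subseteq> {..<N}" "s mod N \<notin> set (top_layer N js)"
  shows "trace_eq N js (stack N s (layers N js))"
  using assms
proof (induction N js arbitrary: s rule: layers.induct)
  case (1 N js)
  show ?case
  proof (cases "js = []")
    case True
    then show ?thesis by (simp add: layers.simps stack_Nil)
  next
    case False
    have split: "trace_eq N js (lower_part N js @ top_layer N js)"
      using 1 by (intro trace_eq_lower_top)
    have "reduced N (lower_part N js)"
      using reduced_factor[of N "[]" "lower_part N js"] reduced_trace_eq[OF _ split] 1(2) by simp
    moreover have lowN: "set (lower_part N js) \<subseteq> {..<N}" using 1(3) set_layer_split[of js N] by auto
    moreover have "Suc s mod N \<notin> set (top_layer N (lower_part N js))"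
    proof
      assume *: "Suc s mod N \<in> set (top_layer N (lower_part N js))"
      from * have N: "Suc s mod N < N" using lowN set_layer_split[of "lower_part N js" N] by auto
      then have sN: "s mod N < N" by (cases "N = 0") auto
      have "pred_mod N (Suc s mod N) = s mod N"
        using pred_mod_eq_iff[OF N sN] by (simp add: succ_mod_def mod_simps)
      with pred_in_top_layer[OF *] 1(4) show False by simp
    qed
    ultimately have "trace_eq N (lower_part N js) (stack N (Suc s) (layers N (lower_part N js)))"
      using 1(1)[OF False] by blast
    from trace_eq_append[OF this trace_eq_sort_top_layer[OF 1(3,4)]] split False show ?thesis
      by (auto simp: layers.simps[of N js] stack_Cons intro: trace_eq_trans)
  qed
qed

text \<open>Read from the left, consider the first letter \<open>i\<close> that belongs to the top layer.  No \<open>i - 1\<close>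
  follows it and none precedes it in the top layer, so \<open>i - 1\<close> is not in the top layer.\<close>

lemma top_layer_omits: "N \<ge> 2 \<Longrightarrow> \<not> {..<N} \<subseteq> set (top_layer N js)"
proof (induction js)
  case (Cons i js)
  show ?case
  proof
    assume all: "{..<N} \<subseteq> set (top_layer N (i # js))"
    show False
    proof (cases "pred_mod N i \<in> set js")
      case True
      with all Cons show False by simp
    next
      case False
      have "pred_mod N i < N" using Cons.prems by (simp add: pred_mod_def)
      with all False have p: "pred_mod N i = i" using set_layer_split[of js N] by auto
      then have "i < N" using \<open>pred_mod N i < N\<close> by simp
      with p pred_mod_eq_iff[of i N i] have "succ_mod N i = i" by simp
      then show False using \<open>i < N\<close> Cons.prems by (cases "Suc i = N") (auto simp: succ_mod_def)
    qed
  qed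
qed (auto simp: lessThan_empty_iff)

lemma successor_closed_full:
  assumes "j \<in> T" "j < N" and step: "\<And>i. i \<in> T \<Longrightarrow> i < N \<Longrightarrow> succ_mod N i \<in> T"
  shows "{..<N} \<subseteq> T"
proof
  fix i assume "i \<in> {..<N}"
  have "(j + k) mod N \<in> T" for k
  proof (induction k)
    case (Suc k)
    from step[OF this] show ?case using assms(2) by (simp add: succ_mod_def mod_simps)
  qed (use assms in simp)
  from this[of "N - j + i"] show "i \<in> T" using assms(2) \<open>i \<in> {..<N}\<close> by simp
qed

lemma top_layer_nonempty: "js \<noteq> [] \<Longrightarrow> top_layer N js \<noteq> []"
proof (induction js)
  case (Cons i js)
  then show ?case by (cases "js = []") auto
qed simp

text \<open>The maximum in \<^const>\<open>hat_index\<close> is over a nonempty set: otherwise the top layer would be closed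
  under cyclic successors and contain every letter.\<close>

lemma hat_index_props:
  assumes "N \<ge> 2" "js \<noteq> []" "set js \<subseteq> {..<N}"
  shows "hat_index N js < N" "hat_index N js \<notin> set (top_layer N js)"
proof -
  let ?T = "set (top_layer N js)"
  let ?S = "{i. i < N \<and> i \<notin> ?T \<and> pred_mod N i \<in> ?T}"
  have "?S \<noteq> {}"
  proof
    assume none: "?S = {}"
    obtain j where j: "j \<in> ?T" using top_layer_nonempty[OF assms(2)] by (meson last_in_set)
    then have jN: "j < N" using assms(3) set_layer_split[of js N] by auto
    have "succ_mod N i \<in> ?T" if "i \<in> ?T" "i < N" for i
    proof -
      have s: "succ_mod N i < N" using that(2) by (simp add: succ_mod_def)
      then have "pred_mod N (succ_mod N i) = i" using pred_mod_eq_iff[OF s that(2)] by simp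
      with none s that(1) show ?thesis by auto
    qed
    from successor_closed_full[OF j jN this] top_layer_omits[OF assms(1)] show False by blast
  qed
  then have "hat_index N js \<in> ?S" unfolding hat_index_def by (intro Max_in) auto
  then show "hat_index N js < N" "hat_index N js \<notin> ?T" by auto
qed

lemma normal_form_eq_stack: "normal_form N js = stack N (hat_index N js) (layers N js)"
  by (simp add: normal_form_def stack_def)

lemma trace_eq_normal_form:
  assumes "N \<ge> 2" "reduced N js" "js \<noteq> []" "set js \<subseteq> {..<N}"
  shows "trace_eq N js (normal_form N js)"
  unfolding normal_form_eq_stack
  using assms hat_index_props[OF assms(1,3,4)] by (intro trace_eq_stack) auto

lemma set_layers: "L \<in> set (layers N js) \<Longrightarrow> set L \<subseteq> set js"
proof (induction N js rule: layers.induct)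
  case (1 N js)
  then show ?case using set_layer_split[of js N]
    by (subst (asm) (2) layers.simps) (fastforce split: if_splits)
qed

text \<open>Equivalent words have equal layers up to commutation, and sorting by an injective key forgets
  the difference.
  Together with \<open>trace_eq_normal_form\<close> this makes \<^const>\<open>normal_form\<close> idempotent on reduced
  words.\<close>

lemma normal_form_trace_eq_cong:
  assumes "trace_eq N w w'" "set w \<subseteq> {..<N}"
  shows "normal_form N w = normal_form N w'"
proof -
  have hat: "hat_index N w = hat_index N w'"
    unfolding hat_index_def trace_eq_set[OF trace_eq_top_layer[OF assms(1)]] ..
  note layers = trace_eq_layers[OF assms(1)]
  have "sort_key (cyclic_pos N s) (layers N w ! n) = sort_key (cyclic_pos N s) (layers N w' ! n)"
    if "n < length (layers N w)" for n s
  proof -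
    have ms: "mset (layers N w ! n) = mset (layers N w' ! n)"
      using list_all2_nthD[OF layers that] trace_eq_mset by blast
    have "set (layers N w ! n) \<subseteq> {..<N}"
      using set_layers[of "layers N w ! n" N w] that assms(2) by fastforce
    then show ?thesis
      by (intro sort_key_inj_key_eq) (auto simp: ms intro: inj_on_subset[OF inj_on_cyclic_pos])
  qed
  then show ?thesis
    unfolding normal_form_def hat list_all2_lengthD[OF layers]
    by (intro arg_cong[where f = "\<lambda>x. concat (rev x)"] map_cong) (auto simp: list_all2_lengthD[OF layers])
qed

section \<open>Linear functionals that vanish on the ideal\<close>

definition word_functional :: "(nat list \<Rightarrow> 'k) \<Rightarrow> 'k::field ncpoly \<Rightarrow> 'k" where
  "word_functional f p = (\<Sum>w\<in>Poly_Mapping.keys p. Poly_Mapping.lookup p w * f (letters w))"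

lemma word_functional_superset:
  assumes "finite S" "Poly_Mapping.keys p \<subseteq> S"
  shows "word_functional f p = (\<Sum>w\<in>S. Poly_Mapping.lookup p w * f (letters w))"
  unfolding word_functional_def
  using assms by (intro sum.mono_neutral_left) (auto simp: in_keys_iff)

lemma word_functional_add:
  "word_functional f (p + q) = word_functional f p + word_functional f q"
proof -
  let ?S = "Poly_Mapping.keys p \<union> Poly_Mapping.keys q"
  have "word_functional f x = (\<Sum>w\<in>?S. Poly_Mapping.lookup x w * f (letters w))"
    if "x \<in> {p, q, p + q}" for x
    using that Poly_Mapping.keys_add[of p q] by (intro word_functional_superset) auto
  then show ?thesis by (simp add: lookup_add distrib_right sum.distrib)
qed

lemma word_functional_zero [simp]: "word_functional f 0 = 0"
  by (simp add: word_functional_def)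

lemma word_functional_uminus: "word_functional f (- p) = - word_functional f p"
  using word_functional_add[of f p "- p"] by (simp add: eq_neg_iff_add_eq_0 add.commute)

lemma word_functional_diff:
  "word_functional f (p - q) = word_functional f p - word_functional f q"
  using word_functional_add[of f p "- q"] by (simp add: word_functional_uminus)

lemma word_functional_single [simp]:
  "word_functional f (Poly_Mapping.single w c) = c * f (letters w)"
  by (simp add: word_functional_def)

lemma word_functional_sum:
  "word_functional f (\<Sum>x\<in>S. p x) = (\<Sum>x\<in>S. word_functional f (p x))"
  by (induction S rule: infinite_finite_induct) (auto simp: word_functional_add)

lemma sum_singles: "p = (\<Sum>w\<in>Poly_Mapping.keys p. Poly_Mapping.single w (Poly_Mapping.lookup p w))"
  by (rule poly_mapping_eqI)
    (simp add: lookup_sum lookup_single when_def sum.delta in_keys_iff)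

lemma word_functional_mult:
  "word_functional f (p * q) =
    (\<Sum>u\<in>Poly_Mapping.keys p. \<Sum>v\<in>Poly_Mapping.keys q.
      Poly_Mapping.lookup p u * Poly_Mapping.lookup q v * f (letters u @ letters v))"
proof -
  have "p * q = (\<Sum>u\<in>Poly_Mapping.keys p. \<Sum>v\<in>Poly_Mapping.keys q.
      Poly_Mapping.single (u + v) (Poly_Mapping.lookup p u * Poly_Mapping.lookup q v))"
    by (subst (1) sum_singles[of p], subst (1) sum_singles[of q])
      (simp add: sum_product mult_single)
  then show ?thesis by (simp add: word_functional_sum)
qed

text \<open>These are the functions on words whose linear extension vanishes on every two-sided multiple
  of a relation; hence the factors \<open>u\<close> and \<open>v\<close>.\<close>

definition relation_compatible :: "nat \<Rightarrow> (nat list \<Rightarrow> 'k::field) \<Rightarrow> bool" where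
  "relation_compatible N f \<longleftrightarrow>
    (\<forall>u x v. x \<in> forbidden N \<longrightarrow> f (u @ x @ v) = 0) \<and>
    (\<forall>u i j v. comm N i j \<longrightarrow> f (u @ i # j # v) = f (u @ j # i # v))"

lemma relation_compatible_append:
  assumes "relation_compatible N f"
  shows "relation_compatible N (\<lambda>w. f (x @ w))" "relation_compatible N (\<lambda>w. f (w @ x))"
  using assms unfolding relation_compatible_def by (metis append.assoc append_Cons)+

lemma var_mult_var: "var i * var j = Poly_Mapping.single (Word [i, j]) 1"
  and single_mult_var: "Poly_Mapping.single (Word [i, j]) 1 * var k = Poly_Mapping.single (Word [i, j, k]) 1"
  by (simp_all add: var_def mult_single plus_free_monoid_def)

lemma nTL_relations_eq:
  "nTL_relations N = (\<lambda>x. Poly_Mapping.single (Word x) 1) ` forbidden N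
    \<union> {Poly_Mapping.single (Word [i, j]) 1 - Poly_Mapping.single (Word [j, i]) 1 |i j. comm N i j}"
  unfolding nTL_relations_def forbidden_def var_mult_var single_mult_var comm_def
  by auto

lemma free_algebra_uminus:
  assumes "p \<in> carrier (free_algebra N)"
  shows "\<ominus>\<^bsub>free_algebra N\<^esub> p = - p"
proof -
  interpret A: ring "free_algebra N" by (rule ring_free_algebra)
  have "- p \<in> carrier (free_algebra N)" using assms by (simp add: free_algebra_def)
  with assms show ?thesis
    by (intro A.minus_equality) (auto simp: free_algebra_def)
qed

text \<open>The common kernel of all these functionals is a two-sided ideal, since translating a compatible
  function by a word on the left or on the right gives a compatible function again.  It contains
  the relations.\<close>

lemma relation_compatible_vanishes:
  assumes N: "N > 0" and f: "relation_compatible N f" and p: "p \<in> nTL_ideal N"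
  shows "word_functional f p = 0"
proof -
  let ?A = "free_algebra N :: ('a, 'a ncpoly) module"
  interpret A: ring ?A by (rule ring_free_algebra)
  define K where "K = {p \<in> carrier ?A. \<forall>f. relation_compatible N f \<longrightarrow> word_functional f p = 0}"
  have "ideal K ?A"
  proof (rule idealI)
    show "ring ?A" ..
    show "subgroup K (add_monoid ?A)"
    proof (rule A.add.subgroupI)
      fix q assume "q \<in> K"
      then show "\<ominus>\<^bsub>?A\<^esub> q \<in> K"
        using A.a_inv_closed[of q] by (auto simp: K_def word_functional_uminus free_algebra_uminus)
    next
      show "K \<noteq> {}"
        using A.zero_closed by (auto simp: K_def free_algebra_def intro!: exI[of _ 0])
    next
      fix q r assume "q \<in> K" "r \<in> K"
      then show "q \<oplus>\<^bsub>?A\<^esub> r \<in> K"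
        using A.a_closed[of q r] by (auto simp: K_def word_functional_add free_algebra_def)
    qed (auto simp: K_def)
    fix q r assume q: "q \<in> K" and r: "r \<in> carrier ?A"
    have mult: "x \<otimes>\<^bsub>?A\<^esub> y = x * y" for x y by (simp add: free_algebra_def)
    have "word_functional g (r * q) = 0" if g: "relation_compatible N g" for g
    proof -
      have "word_functional g (r * q) = (\<Sum>u\<in>Poly_Mapping.keys r.
          Poly_Mapping.lookup r u * word_functional (\<lambda>w. g (letters u @ w)) q)"
        unfolding word_functional_mult
        by (simp add: word_functional_def sum_distrib_left mult.assoc)
      also have "\<dots> = 0"
        using q relation_compatible_append(1)[OF g] by (simp add: K_def)
      finally show ?thesis .
    qed
    then show "r \<otimes>\<^bsub>?A\<^esub> q \<in> K"
      using A.m_closed[OF r, of q] q by (auto simp: K_def mult)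
    have "word_functional g (q * r) = 0" if g: "relation_compatible N g" for g
    proof -
      have "word_functional g (q * r) = (\<Sum>u\<in>Poly_Mapping.keys r.
          Poly_Mapping.lookup r u * word_functional (\<lambda>w. g (w @ letters u)) q)"
        unfolding word_functional_mult
        by (subst sum.swap) (simp add: word_functional_def sum_distrib_left mult_ac)
      also have "\<dots> = 0"
        using q relation_compatible_append(2)[OF g] by (simp add: K_def)
      finally show ?thesis .
    qed
    then show "q \<otimes>\<^bsub>?A\<^esub> r \<in> K"
      using A.m_closed[OF _ r, of q] q by (auto simp: K_def mult)
  qed
  moreover have "nTL_relations N \<subseteq> K"
  proof
    fix r :: "'a ncpoly" assume r: "r \<in> nTL_relations N"
    have "word_functional g r = 0" if g: "relation_compatible N g" for g
    proof -
      have "g x = 0" if "x \<in> forbidden N" for x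
        using g that unfolding relation_compatible_def by (metis append_Nil append_Nil2)
      moreover have "g [i, j] = g [j, i]" if "comm N i j" for i j
        using g that unfolding relation_compatible_def by (metis append_Nil)
      ultimately show ?thesis
        using r unfolding nTL_relations_eq by (auto simp: word_functional_diff)
    qed
    with r nTL_relations_subset[OF N] show "r \<in> K" by (auto simp: K_def)
  qed
  ultimately have "nTL_ideal N \<subseteq> K" unfolding nTL_ideal_def by (rule A.genideal_minimal)
  with p f show ?thesis by (auto simp: K_def)
qed

section \<open>Monomials in the quotient algebra\<close>

definition nTL_coset :: "nat \<Rightarrow> 'k::field ncpoly \<Rightarrow> 'k ncpoly set" where
  "nTL_coset N p = nTL_ideal N +>\<^bsub>free_algebra N\<^esub> p"

lemma single_in_free_algebra:
  "set w \<subseteq> {..<N} \<Longrightarrow> Poly_Mapping.single (Word w) c \<in> carrier (free_algebra N)"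
  by (simp add: free_algebra_def)

lemma nTL_coset_closed: "p \<in> carrier (free_algebra N) \<Longrightarrow> nTL_coset N p \<in> carrier (nTL N)"
  by (auto simp: nTL_simps FactRing_def A_RCOSETS_def' nTL_coset_def)

lemma nTL_coset_exhaust:
  assumes "X \<in> carrier (nTL N)"
  obtains p where "p \<in> carrier (free_algebra N)" "X = nTL_coset N p"
  using assms by (auto simp: nTL_simps FactRing_def A_RCOSETS_def' nTL_coset_def)

lemma nTL_coset_add:
  assumes "N > 0" "p \<in> carrier (free_algebra N)" "q \<in> carrier (free_algebra N)"
  shows "nTL_coset N p \<oplus>\<^bsub>nTL N\<^esub> nTL_coset N q = nTL_coset N (p + q)"
  using ideal.a_rcos_sum[OF nTL_ideal[OF assms(1)] assms(2,3)]
  by (simp add: nTL_simps FactRing_def nTL_coset_def) (simp add: free_algebra_def)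

lemma nTL_coset_mult:
  assumes "N > 0" "p \<in> carrier (free_algebra N)" "q \<in> carrier (free_algebra N)"
  shows "nTL_coset N p \<otimes>\<^bsub>nTL N\<^esub> nTL_coset N q = nTL_coset N (p * q)"
  using ideal.rcoset_mult_add[OF nTL_ideal[OF assms(1)] assms(2,3)]
  by (simp add: nTL_simps FactRing_def nTL_coset_def) (simp add: free_algebra_def)

lemma nTL_coset_smult_single:
  assumes "N > 0" "set w \<subseteq> {..<N}"
  shows "c \<odot>\<^bsub>nTL N\<^esub> nTL_coset N (Poly_Mapping.single (Word w) d) =
    nTL_coset N (Poly_Mapping.single (Word w) (c * d))"
  unfolding nTL_coset_def nTL_smult_coset[OF assms(1) single_in_free_algebra[OF assms(2)]]
  by (simp add: free_algebra_def mult_map_scale_conv_mult mult_single)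

lemma nTL_coset_zero: "N > 0 \<Longrightarrow> nTL_coset N 0 = \<zero>\<^bsub>nTL N\<^esub>"
proof -
  assume "N > 0"
  then interpret I: ideal "nTL_ideal N" "free_algebra N" by (rule nTL_ideal)
  have "nTL_ideal N +>\<^bsub>free_algebra N\<^esub> \<zero>\<^bsub>free_algebra N\<^esub> = nTL_ideal N"
    by (rule I.a_coset_add_zero[OF I.a_subset])
  then show ?thesis by (simp add: nTL_simps FactRing_def nTL_coset_def free_algebra_def)
qed

lemma nTL_coset_one: "N > 0 \<Longrightarrow> nTL_coset N 1 = \<one>\<^bsub>nTL N\<^esub>"
  by (simp add: nTL_simps FactRing_def nTL_coset_def) (simp add: free_algebra_def)

lemma nTL_coset_eq_iff:
  assumes "N > 0" "p \<in> carrier (free_algebra N)" "q \<in> carrier (free_algebra N)"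
  shows "nTL_coset N p = nTL_coset N q \<longleftrightarrow> p - q \<in> nTL_ideal N"
proof -
  interpret A: ring "free_algebra N" by (rule ring_free_algebra)
  have "p \<ominus>\<^bsub>free_algebra N\<^esub> q = p - q"
    using assms(3) by (simp add: a_minus_def free_algebra_uminus) (simp add: free_algebra_def)
  with A.quotient_eq_iff_same_a_r_cos[OF nTL_ideal[OF assms(1)] assms(2,3)] show ?thesis
    by (simp add: nTL_coset_def)
qed

lemma nTL_coset_eq_zero_iff:
  assumes "N > 0" "p \<in> carrier (free_algebra N)"
  shows "nTL_coset N p = \<zero>\<^bsub>nTL N\<^esub> \<longleftrightarrow> p \<in> nTL_ideal N"
  using nTL_coset_eq_iff[OF assms, of 0]
  by (simp add: nTL_coset_zero[OF assms(1)]) (simp add: free_algebra_def)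

lemma relations_in_ideal: "N > 0 \<Longrightarrow> nTL_relations N \<subseteq> nTL_ideal N"
  unfolding nTL_ideal_def
  by (rule ring.genideal_self[OF ring_free_algebra nTL_relations_subset])

lemma nTL_monomial_eq_coset:
  assumes "N > 0" "set w \<subseteq> {..<N}"
  shows "nTL_monomial N w = nTL_coset N (Poly_Mapping.single (Word w) 1 :: 'k::field ncpoly)"
  using assms(2)
proof (induction w)
  case Nil
  show ?case
    by (simp add: nTL_monomial_def nTL_coset_one[OF assms(1)] flip: zero_free_monoid_def)
next
  case (Cons i w)
  have "nTL_monomial N (i # w) = nTL_coset N (var i :: 'k ncpoly) \<otimes>\<^bsub>nTL N\<^esub> nTL_monomial N w"
    by (simp add: nTL_monomial_def nTL_gen_def nTL_coset_def)
  also have "\<dots> = nTL_coset N (var i * Poly_Mapping.single (Word w) 1)"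
    using Cons by (simp add: nTL_coset_mult[OF assms(1)] single_in_free_algebra var_def)
  finally show ?case by (simp add: var_def mult_single plus_free_monoid_def)
qed

lemma nTL_monomial_closed:
  assumes "N > 0" "set w \<subseteq> {..<N}"
  shows "nTL_monomial N w \<in> carrier (nTL N)"
  unfolding nTL_monomial_eq_coset[OF assms]
  by (intro nTL_coset_closed single_in_free_algebra assms)

lemma nTL_monomial_append:
  assumes "N > 0" "set u \<subseteq> {..<N}" "set v \<subseteq> {..<N}"
  shows "nTL_monomial N (u @ v) = nTL_monomial N u \<otimes>\<^bsub>nTL N\<^esub> nTL_monomial N v"
  using assms
  by (simp add: nTL_monomial_eq_coset nTL_coset_mult single_in_free_algebra mult_single
      plus_free_monoid_def)

lemma nTL_monomial_swap:
  assumes "N > 0" "comm N i j" "set u \<subseteq> {..<N}" "set v \<subseteq> {..<N}"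
  shows "(nTL_monomial N (u @ i # j # v) :: 'k::field ncpoly set) = nTL_monomial N (u @ j # i # v)"
proof -
  have ij: "i < N" "j < N" using assms(2) by (auto simp: comm_def)
  have "Poly_Mapping.single (Word [i, j]) 1 - Poly_Mapping.single (Word [j, i]) 1
      \<in> (nTL_ideal N :: 'k ncpoly set)"
    using relations_in_ideal[OF assms(1)] assms(2) unfolding nTL_relations_eq by blast
  then have "(nTL_monomial N [i, j] :: 'k ncpoly set) = nTL_monomial N [j, i]"
    using ij assms(1) by (simp add: nTL_monomial_eq_coset nTL_coset_eq_iff single_in_free_algebra)
  moreover have "(nTL_monomial N (u @ x @ v) :: 'k ncpoly set) =
      nTL_monomial N u \<otimes>\<^bsub>nTL N\<^esub> (nTL_monomial N x \<otimes>\<^bsub>nTL N\<^esub> nTL_monomial N v)"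
    if "set x \<subseteq> {..<N}" for x
    using assms that by (simp add: nTL_monomial_append)
  from this[of "[i, j]"] this[of "[j, i]"] calculation show ?thesis using ij by simp
qed

lemma nTL_monomial_forbidden:
  assumes "N > 0" "x \<in> forbidden N" "set u \<subseteq> {..<N}" "set v \<subseteq> {..<N}"
  shows "nTL_monomial N (u @ x @ v) = (\<zero>\<^bsub>nTL N\<^esub> :: 'k::field ncpoly set)"
proof -
  interpret V: ring "nTL N :: ('k, 'k ncpoly set) module" by (rule ring_nTL[OF assms(1)])
  have x: "set x \<subseteq> {..<N}" using assms(1,2) by (auto simp: forbidden_def succ_mod_def)
  have "Poly_Mapping.single (Word x) 1 \<in> (nTL_ideal N :: 'k ncpoly set)"
    using relations_in_ideal[OF assms(1)] assms(2) unfolding nTL_relations_eq by blast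
  then have "nTL_monomial N x = (\<zero>\<^bsub>nTL N\<^esub> :: 'k ncpoly set)"
    using x assms(1)
    by (simp add: nTL_monomial_eq_coset nTL_coset_eq_zero_iff single_in_free_algebra)
  then show ?thesis
    using assms x by (simp add: nTL_monomial_append nTL_monomial_closed)
qed

lemma nTL_monomial_trace_eq:
  assumes "trace_eq N w w'" "N > 0" "set w \<subseteq> {..<N}"
  shows "nTL_monomial N w' = (nTL_monomial N w :: 'k::field ncpoly set)"
  using assms
proof (induction rule: trace_eq.induct)
  case (swap w u i j v)
  then have "set (u @ i # j # v) \<subseteq> {..<N}" using trace_eq_set by metis
  then have "nTL_monomial N (u @ j # i # v) = (nTL_monomial N (u @ i # j # v) :: 'k ncpoly set)"
    using swap by (intro nTL_monomial_swap[symmetric]) auto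
  with swap show ?case by simp
qed simp

lemma reduced_if_nonzero:
  assumes "N > 0" "set w \<subseteq> {..<N}" "nTL_monomial N w \<noteq> (\<zero>\<^bsub>nTL N\<^esub> :: 'k::field ncpoly set)"
  shows "reduced N w"
  unfolding reduced_def
proof (intro allI impI notI)
  fix u x v assume *: "trace_eq N w (u @ x @ v)" "x \<in> forbidden N"
  have "set (u @ x @ v) \<subseteq> {..<N}" using trace_eq_set[OF *(1)] assms(2) by blast
  then have "nTL_monomial N (u @ x @ v) = (\<zero>\<^bsub>nTL N\<^esub> :: 'k ncpoly set)"
    using assms(1) *(2) by (intro nTL_monomial_forbidden) auto
  with nTL_monomial_trace_eq[OF *(1) assms(1,2)] assms(3) show False by metis
qed

section \<open>Linear independence and spanning\<close>

text \<open>This is the coordinate functional of the nonzero monomial \<open>m\<close>.  Commutations do not change the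
  value of a word, and a word with a forbidden factor has value zero and hence not \<open>m\<close>.\<close>

lemma relation_compatible_indicator:
  assumes "N > 0" "m \<noteq> (\<zero>\<^bsub>nTL N\<^esub> :: 'k::field ncpoly set)"
  shows "relation_compatible N
    (\<lambda>w. if set w \<subseteq> {..<N} \<and> nTL_monomial N w = m then 1 else 0 :: 'k)"
    (is "relation_compatible N ?f")
  unfolding relation_compatible_def
proof (intro conjI allI impI)
  fix u x v assume x: "x \<in> forbidden N"
  have "nTL_monomial N (u @ x @ v) \<noteq> m" if "set (u @ x @ v) \<subseteq> {..<N}"
    using nTL_monomial_forbidden[OF assms(1) x, of u v, where 'k = 'k] that assms(2) by simp
  then show "?f (u @ x @ v) = 0" by metis
next
  fix u i j v assume ij: "comm N i j"
  have "nTL_monomial N (u @ i # j # v) = (nTL_monomial N (u @ j # i # v) :: 'k ncpoly set)"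
    if "set (u @ i # j # v) \<subseteq> {..<N}"
    using that by (intro nTL_monomial_swap[OF assms(1) ij]) auto
  moreover have "set (u @ i # j # v) = set (u @ j # i # v)" by auto
  ultimately show "?f (u @ i # j # v) = ?f (u @ j # i # v)" by metis
qed

lemma relation_compatible_Nil: "relation_compatible N (\<lambda>w. if w = [] then 1 else 0)"
  by (auto simp: relation_compatible_def forbidden_def)

text \<open>No relation involves the empty word, so the constant coefficient is well defined on the
  quotient.\<close>

lemma nTL_one_nonzero:
  assumes "N > 0" shows "\<one>\<^bsub>nTL N\<^esub> \<noteq> (\<zero>\<^bsub>nTL N\<^esub> :: 'k::field ncpoly set)"
proof
  assume "\<one>\<^bsub>nTL N\<^esub> = (\<zero>\<^bsub>nTL N\<^esub> :: 'k ncpoly set)"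
  then have "nTL_coset N (Poly_Mapping.single (Word []) 1) = (\<zero>\<^bsub>nTL N\<^esub> :: 'k ncpoly set)"
    using nTL_monomial_eq_coset[OF assms, of "[]", where 'k = 'k] by (simp add: nTL_monomial_def)
  then have "(Poly_Mapping.single (Word []) 1 :: 'k ncpoly) \<in> nTL_ideal N"
    by (simp add: nTL_coset_eq_zero_iff[OF assms] single_in_free_algebra)
  from relation_compatible_vanishes[OF assms relation_compatible_Nil this] show False by simp
qed

lemma finsum_monomials:
  assumes "N > 0" "finite A" "\<And>m. m \<in> A \<Longrightarrow> set (w m) \<subseteq> {..<N} \<and> m = nTL_monomial N (w m)"
  shows "finsum (nTL N) (\<lambda>m. a m \<odot>\<^bsub>nTL N\<^esub> m) A =
      nTL_coset N (\<Sum>m\<in>A. Poly_Mapping.single (Word (w m)) (a m))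
    \<and> (\<Sum>m\<in>A. Poly_Mapping.single (Word (w m)) (a m)) \<in> carrier (free_algebra N)"
  using assms(2,3)
proof (induction A rule: finite_induct)
  case empty
  interpret V: ring "nTL N" by (rule ring_nTL[OF assms(1)])
  show ?case by (simp add: nTL_coset_zero[OF assms(1)]) (simp add: free_algebra_def)
next
  case (insert m A)
  interpret V: ring "nTL N" by (rule ring_nTL[OF assms(1)])
  interpret A: ring "free_algebra N" by (rule ring_free_algebra)
  have smult: "a x \<odot>\<^bsub>nTL N\<^esub> x = nTL_coset N (Poly_Mapping.single (Word (w x)) (a x))"
    if "x \<in> insert m A" for x
    using insert.prems[OF that] assms(1) nTL_coset_smult_single[OF assms(1), of "w x" "a x" 1]
    by (metis mult_1_right nTL_monomial_eq_coset)
  then have closed: "a x \<odot>\<^bsub>nTL N\<^esub> x \<in> carrier (nTL N)" if "x \<in> insert m A" for x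
    using insert.prems[OF that] that by (simp add: nTL_coset_closed single_in_free_algebra)
  have s: "Poly_Mapping.single (Word (w m)) (a m) \<in> carrier (free_algebra N)"
    using insert.prems by (simp add: single_in_free_algebra)
  have "finsum (nTL N) (\<lambda>m. a m \<odot>\<^bsub>nTL N\<^esub> m) (insert m A) =
    a m \<odot>\<^bsub>nTL N\<^esub> m \<oplus>\<^bsub>nTL N\<^esub> finsum (nTL N) (\<lambda>m. a m \<odot>\<^bsub>nTL N\<^esub> m) A"
    using insert closed by (intro V.finsum_insert) auto
  also have "\<dots> = nTL_coset N (Poly_Mapping.single (Word (w m)) (a m) +
      (\<Sum>m\<in>A. Poly_Mapping.single (Word (w m)) (a m)))"
    using insert s smult[of m] by (simp add: nTL_coset_add[OF assms(1)])
  moreover have "Poly_Mapping.single (Word (w m)) (a m) +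
      (\<Sum>m\<in>A. Poly_Mapping.single (Word (w m)) (a m)) \<in> carrier (free_algebra N)"
    using A.a_closed[OF s, of "\<Sum>m\<in>A. Poly_Mapping.single (Word (w m)) (a m)"] insert
    by (simp add: free_algebra_def)
  ultimately show ?case using insert.hyps by simp
qed

text \<open>Applying to a linear relation the coordinate functional of one of its monomials isolates the
  coefficient of that monomial.\<close>

lemma nonzero_monomials_independent:
  assumes "N > 0" and S: "\<And>m. m \<in> S \<Longrightarrow> m \<noteq> \<zero>\<^bsub>nTL N\<^esub> \<and> (\<exists>w. set w \<subseteq> {..<N} \<and> m = nTL_monomial N w)"
  shows "\<not> module.lin_dep (class_ring :: 'k::field ring) (nTL N) S"
proof
  interpret V: vectorspace "class_ring :: 'k ring" "nTL N" by (rule vectorspace_nTL[OF assms(1)])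
  assume "V.lin_dep S"
  then obtain A a m where A: "finite A" "A \<subseteq> S" "V.lincomb a A = \<zero>\<^bsub>nTL N\<^esub>"
    and m: "m \<in> A" "a m \<noteq> 0"
    unfolding V.lin_dep_def by auto
  obtain w where w: "\<And>m. m \<in> S \<Longrightarrow> set (w m) \<subseteq> {..<N} \<and> m = nTL_monomial N (w m)"
    using S by metis
  let ?p = "\<Sum>m\<in>A. Poly_Mapping.single (Word (w m)) (a m)"
  have "nTL_coset N ?p = \<zero>\<^bsub>nTL N\<^esub>" "?p \<in> carrier (free_algebra N)"
    using finsum_monomials[OF assms(1) A(1), of w a] w A(2,3) unfolding V.lincomb_def by auto
  then have p: "?p \<in> nTL_ideal N" using nTL_coset_eq_zero_iff[OF assms(1)] by blast
  let ?f = "\<lambda>u. if set u \<subseteq> {..<N} \<and> nTL_monomial N u = m then 1 else 0 :: 'k"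
  have "0 = word_functional ?f ?p"
    using relation_compatible_vanishes[OF assms(1) relation_compatible_indicator[OF assms(1)] p, of m]
      S m A by auto
  also have "\<dots> = (\<Sum>x\<in>A. if x = m then a x else 0)"
    unfolding word_functional_sum
  proof (rule sum.cong)
    fix x assume "x \<in> A"
    then have "set (w x) \<subseteq> {..<N}" "nTL_monomial N (w x) = x" using w[of x] A(2) by auto
    then show "word_functional ?f (Poly_Mapping.single (Word (w x)) (a x)) = (if x = m then a x else 0)"
      by simp
  qed simp
  also have "\<dots> = a m" using A(1) m(1) by simp
  finally show False using m(2) by simp
qed

lemma monomials_span:
  assumes "N > 0" and S: "S \<subseteq> carrier (nTL N)"
    and mono: "\<And>w. set w \<subseteq> {..<N} \<Longrightarrow>
      nTL_monomial N w \<noteq> (\<zero>\<^bsub>nTL N\<^esub> :: 'k ncpoly set) \<Longrightarrow> nTL_monomial N w \<in> S"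
  shows "LinearCombinations.module.span (class_ring :: 'k::field ring) (nTL N) S = carrier (nTL N)"
proof -
  interpret V: vectorspace "class_ring :: 'k ring" "nTL N" by (rule vectorspace_nTL[OF assms(1)])
  interpret R: ring "nTL N" by (rule ring_nTL[OF assms(1)])
  have sub: "submodule class_ring (V.span S) (nTL N)" by (rule V.span_is_submodule[OF S])
  have zero: "\<zero>\<^bsub>nTL N\<^esub> \<in> V.span S" using sub by (simp add: submodule_def)
  have single: "nTL_coset N (Poly_Mapping.single x c) \<in> V.span S"
    if x: "set (letters x) \<subseteq> {..<N}" for x c
  proof -
    have "nTL_monomial N (letters x) \<in> V.span S"
      using mono[OF x] V.in_own_span[OF S] zero by (metis subsetD)
    then have "c \<odot>\<^bsub>nTL N\<^esub> nTL_monomial N (letters x) \<in> V.span S"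
      using sub by (simp add: submodule_def)
    then show ?thesis
      using nTL_coset_smult_single[OF assms(1) x, of c 1]
      by (simp add: nTL_monomial_eq_coset[OF assms(1) x])
  qed
  have sums: "nTL_coset N (\<Sum>x\<in>X. Poly_Mapping.single x (c x)) \<in> V.span S
      \<and> (\<Sum>x\<in>X. Poly_Mapping.single x (c x)) \<in> carrier (free_algebra N)"
    if "finite X" "\<forall>x\<in>X. set (letters x) \<subseteq> {..<N}" for X c
    using that
  proof (induction X rule: finite_induct)
    case empty
    then show ?case using zero by (simp add: nTL_coset_zero[OF assms(1)]) (simp add: free_algebra_def)
  next
    case (insert x X)
    interpret A: ring "free_algebra N :: ('k, 'k ncpoly) module" by (rule ring_free_algebra)
    have s: "Poly_Mapping.single x (c x) \<in> carrier (free_algebra N)"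
      using insert.prems by (simp add: free_algebra_def)
    let ?q = "\<Sum>x\<in>X. Poly_Mapping.single x (c x)"
    have IH: "nTL_coset N ?q \<in> V.span S" "?q \<in> carrier (free_algebra N)"
      using insert by auto
    have "nTL_coset N (Poly_Mapping.single x (c x)) \<oplus>\<^bsub>nTL N\<^esub> nTL_coset N ?q \<in> V.span S"
      using single insert.prems IH(1) sub by (simp add: submodule_def)
    then have "nTL_coset N (Poly_Mapping.single x (c x) + ?q) \<in> V.span S"
      by (simp add: nTL_coset_add[OF assms(1) s IH(2)])
    moreover have "Poly_Mapping.single x (c x) + ?q \<in> carrier (free_algebra N)"
      using A.a_closed[OF s IH(2)] by (simp add: free_algebra_def)
    ultimately show ?case using insert.hyps by simp
  qed
  have coset: "nTL_coset N p \<in> V.span S" if "p \<in> carrier (free_algebra N)" for p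
    using that sums[of "Poly_Mapping.keys p" "Poly_Mapping.lookup p"]
    unfolding sum_singles[of p, symmetric] by (simp add: free_algebra_def)
  have "carrier (nTL N) \<subseteq> V.span S"
  proof
    fix X :: "'k ncpoly set" assume "X \<in> carrier (nTL N)"
    then show "X \<in> V.span S" using coset by (elim nTL_coset_exhaust) simp
  qed
  with V.span_is_subset2[OF S] show ?thesis by blast
qed

theorem theorem8p6:
  fixes N :: nat
  assumes "N \<ge> 3"
  shows "vectorspace.basis (class_ring :: 'k::field ring) (nTL N)
           (normal_form_monomials N \<union> {\<one>\<^bsub>nTL N\<^esub>})"
proof -
  have N: "N > 0" "N \<ge> 2" using assms by auto
  interpret V: vectorspace "class_ring :: 'k ring" "nTL N" by (rule vectorspace_nTL[OF N(1)])
  let ?B = "normal_form_monomials N \<union> {\<one>\<^bsub>nTL N\<^esub>} :: 'k ncpoly set set"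
  have one: "\<one>\<^bsub>nTL N\<^esub> = nTL_monomial N []" by (simp add: nTL_monomial_def)
  have nonzero: "m \<noteq> \<zero>\<^bsub>nTL N\<^esub> \<and> (\<exists>w. set w \<subseteq> {..<N} \<and> m = nTL_monomial N w)" if "m \<in> ?B" for m
  proof (cases "m = \<one>\<^bsub>nTL N\<^esub>")
    case True
    then show ?thesis using nTL_one_nonzero[OF N(1)] one by (intro conjI exI[of _ "[]"]) auto
  next
    case False
    with that have "m \<in> normal_form_monomials N" by blast
    then obtain w where "m = nTL_monomial N w" "set w \<subseteq> {..<N}" "m \<noteq> \<zero>\<^bsub>nTL N\<^esub>"
      unfolding normal_form_monomials_def by fast
    then show ?thesis by metis
  qed
  have B: "?B \<subseteq> carrier (nTL N)"
  proof
    fix m assume "m \<in> ?B"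
    then obtain w where "set w \<subseteq> {..<N}" "m = nTL_monomial N w" using nonzero by metis
    then show "m \<in> carrier (nTL N)" using nTL_monomial_closed[OF N(1)] by simp
  qed
  have "nTL_monomial N w \<in> ?B"
    if w: "set w \<subseteq> {..<N}" "nTL_monomial N w \<noteq> (\<zero>\<^bsub>nTL N\<^esub> :: 'k ncpoly set)" for w
  proof (cases "w = []")
    case False
    let ?v = "normal_form N w"
    have eq: "trace_eq N w ?v"
      using trace_eq_normal_form[OF N(2) reduced_if_nonzero[OF N(1) w] False w(1)] .
    have v: "set ?v = set w" using trace_eq_set[OF eq] by simp
    have val: "(nTL_monomial N ?v :: 'k ncpoly set) = nTL_monomial N w"
      by (rule nTL_monomial_trace_eq[OF eq N(1) w(1)])
    have "normal_form N ?v = ?v" using normal_form_trace_eq_cong[OF eq w(1)] by simp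
    with v val w False have "nTL_monomial N ?v \<in> ?B"
      unfolding normal_form_monomials_def by (intro UnI1 CollectI exI[of _ ?v]) auto
    with val show ?thesis by simp
  qed (simp add: one)
  from monomials_span[OF N(1) B this] nonzero_monomials_independent[OF N(1) nonzero] B
  show ?thesis unfolding V.basis_def by blast
qed

end
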